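(* There is an absolute constant $C>0$ (independent of the dimension) such that for every $n\in\mathbb{N}$, $n\ge 1$, and every $f\in L^1(\mathbb{R}^n)$, $$\|\mathcal{H}_{\ast}f\|_{L^{1,\infty}(\mathbb{R}^n)}\le C\log(1+n)\,\|f\|_{L^1(\mathbb{R}^n)}.$$
   Context: $\mathcal{H}_\ast$ is the heat maximal operator $\mathcal{H}_\ast f(x)=\sup_{t>0}|H_tf(x)|$, where $H_tf=h_t*f$ and $h_t(x)=(4\pi t)^{-n/2}e^{-|x|^2/(4t)}$ is the heat kernel on $\mathbb{R}^n$. The weak-$L^1$ quasinorm is $\|g\|_{L^{1,\infty}(\mathbb{R}^n)}=\sup_{\alpha>0}\alpha\,|\{x\in\mathbb{R}^n: |g(x)|>\alpha\}|$, with $|\cdot|$ of a set denoting Lebesgue measure. *)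

theory Defs
  imports "HOL-Analysis.Analysis"
begin

text \<open>
  The constant in the theorem has to be chosen before the dimension, so the dimension must be an
  ordinary number rather than a type. Points of $n$-dimensional Euclidean space are therefore the
  extensional functions in \<open>{..<n} \<rightarrow>\<^sub>E UNIV\<close>, the underlying set of the finite product measure
  \<open>Pi\<^sub>M {..<n} (\<lambda>_. lborel)\<close>. As for the constant \<open>lebesgue\<close>, Lebesgue measure is the completion
  of the Borel measure.
\<close>

definition leb :: "nat \<Rightarrow> (nat \<Rightarrow> real) measure" where
  "leb n = completion (Pi\<^sub>M {..<n} (\<lambda>_. lborel))"

definition heat_kernel :: "nat \<Rightarrow> real \<Rightarrow> (nat \<Rightarrow> real) \<Rightarrow> real" where
  "heat_kernel n t x = (4 * pi * t) powr (- real n / 2) * exp (- (\<Sum>i<n. (x i)\<^sup>2) / (4 * t))"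

definition convolve ::
    "nat \<Rightarrow> ((nat \<Rightarrow> real) \<Rightarrow> real) \<Rightarrow> ((nat \<Rightarrow> real) \<Rightarrow> complex) \<Rightarrow> (nat \<Rightarrow> real) \<Rightarrow> complex" where
  "convolve n g f x = (\<integral>y. complex_of_real (g (\<lambda>i\<in>{..<n}. x i - y i)) * f y \<partial>leb n)"

definition heat_op ::
    "nat \<Rightarrow> real \<Rightarrow> ((nat \<Rightarrow> real) \<Rightarrow> complex) \<Rightarrow> (nat \<Rightarrow> real) \<Rightarrow> complex" where
  "heat_op n t f = convolve n (heat_kernel n t) f"

text \<open>The supremum may be infinite at some points, hence the extended values.\<close>

definition heat_maximal ::
    "nat \<Rightarrow> ((nat \<Rightarrow> real) \<Rightarrow> complex) \<Rightarrow> (nat \<Rightarrow> real) \<Rightarrow> ennreal" where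
  "heat_maximal n f x = (SUP t\<in>{0<..}. ennreal (norm (heat_op n t f x)))"

text \<open>
  The argument \<open>g\<close> stands for the absolute value of the function being measured. For
  \<open>g = heat_maximal n f\<close> with \<open>f\<close> integrable, the superlevel sets are open, being unions over
  \<open>t\<close> of superlevel sets of continuous functions, so \<open>emeasure\<close> is applied to measurable sets only.
\<close>

definition weak_L1_norm :: "nat \<Rightarrow> ((nat \<Rightarrow> real) \<Rightarrow> ennreal) \<Rightarrow> ennreal" where
  "weak_L1_norm n g =
     (SUP \<alpha>\<in>{0<..}. ennreal \<alpha> * emeasure (leb n) {x \<in> space (leb n). g x > ennreal \<alpha>})"

definition L1_norm :: "nat \<Rightarrow> ((nat \<Rightarrow> real) \<Rightarrow> complex) \<Rightarrow> ennreal" where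
  "L1_norm n f = (\<integral>\<^sup>+x. ennreal (norm (f x)) \<partial>leb n)"

end

theory Submission
  imports Defs "HOL-Probability.Probability"
begin

text \<open>
  Restricting \<open>t\<close> to a grid of ratio \<open>1 + 1/n\<close> costs a bounded factor. Linearise the maximal function
  on the grid: let \<open>F i\<close> be the set of points where \<open>i\<close> is the first index at which
  \<open>H\<close> at time \<open>t i\<close> exceeds the level, and consider the potential
  \<open>W i = (\<Sum>j\<ge>i. H (t j - t i) (indicator (F j)))\<close>. By the maximum principle, \<open>W \<le> L\<close> everywhere as soon
  as \<open>W i \<le> L\<close> on each \<open>F i\<close>, and then duality bounds the total measure of the \<open>F i\<close> by
  \<open>L\<close> times the \<open>L\<^sup>1\<close> norm divided by the level. Discarding points where \<open>W i\<close> is large, it suffices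
  to bound the average of \<open>W i\<close> over the sets \<open>F i\<close>, that is, the energy
  \<open>\<Sum>i\<le>j. \<langle>indicator (F i), H (t j - t i) (indicator (F j))\<rangle>\<close>, by \<open>L\<close> times their total measure.

  If \<open>b\<close> separates the times \<open>t i\<close>, \<open>i \<in> I\<close>, from the times \<open>t j\<close>, \<open>j \<in> J\<close>, then
  \<open>H (t j - t i) = H (b - t i) H (t j - b)\<close>, and the dual of the dimension-free maximal inequality
  on \<open>L\<^sup>2\<close> bounds the interaction of \<open>I\<close> with \<open>J\<close> by the measure of the sets involved. A dyadic
  decomposition of the indices thus costs \<open>O(1)\<close> per dyadic scale. Pairs of times with ratio at least
  \<open>2n\<close> contribute \<open>O(1)\<close> altogether because their kernels satisfy \<open>h (t j - t i) \<le> 2 h (t j)\<close>; the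
  remaining pairs have indices within \<open>O(n\<^sup>2)\<close> of each other, which leaves \<open>O(log (1 + n))\<close> scales.
\<close>

section \<open>Symmetric Markov semigroups given by kernels\<close>

lemma ennreal_two_mult_le_squares: "2 * (a * b) \<le> a\<^sup>2 + (b::ennreal)\<^sup>2"
proof (cases a; cases b)
  fix r s :: real assume "a = ennreal r" "b = ennreal s" "0 \<le> r" "0 \<le> s"
  moreover have "ennreal (2 * (r * s)) \<le> ennreal (r\<^sup>2 + s\<^sup>2)"
    by (intro ennreal_leI) (use sum_squares_bound[of r s] in simp)
  ultimately show ?thesis
    by (simp add: ennreal_mult ennreal_power)
qed (auto simp: power2_eq_square ennreal_mult_top ennreal_top_mult)

text \<open>\<open>k t\<close> is the transition density of a reversible Markov process with
  stationary measure \<open>M\<close>; \<open>k_add\<close> is the Chapman-Kolmogorov equation.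
  Values in \<open>ennreal\<close> let every integral exist without integrability
  conditions.\<close>

locale symmetric_markov_kernels = sigma_finite_measure M for M :: "'a measure" +
  fixes k :: "real \<Rightarrow> 'a \<Rightarrow> 'a \<Rightarrow> ennreal"
  assumes k_measurable: "t > 0 \<Longrightarrow> case_prod (k t) \<in> borel_measurable (M \<Otimes>\<^sub>M M)"
    and k_sym: "t > 0 \<Longrightarrow> x \<in> space M \<Longrightarrow> y \<in> space M \<Longrightarrow> k t x y = k t y x"
    and k_one: "t > 0 \<Longrightarrow> x \<in> space M \<Longrightarrow> (\<integral>\<^sup>+y. k t x y \<partial>M) = 1"
    and k_add: "s > 0 \<Longrightarrow> t > 0 \<Longrightarrow> x \<in> space M \<Longrightarrow> z \<in> space M \<Longrightarrow>
      (\<integral>\<^sup>+y. k s x y * k t y z \<partial>M) = k (s + t) x z"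
begin

text \<open>The identity at time 0 has no density, so it is a separate case; it occurs for the
  differences \<open>t i - t i\<close>.\<close>

definition P :: "real \<Rightarrow> ('a \<Rightarrow> ennreal) \<Rightarrow> 'a \<Rightarrow> ennreal" where
  "P t g x = (if t = 0 then g x else \<integral>\<^sup>+y. k t x y * g y \<partial>M)"

definition ip :: "('a \<Rightarrow> ennreal) \<Rightarrow> ('a \<Rightarrow> ennreal) \<Rightarrow> ennreal" where
  "ip f g = (\<integral>\<^sup>+x. f x * g x \<partial>M)"

abbreviation sqnorm :: "('a \<Rightarrow> ennreal) \<Rightarrow> ennreal" where
  "sqnorm f \<equiv> (\<integral>\<^sup>+x. (f x)\<^sup>2 \<partial>M)"

section \<open>Calculus of the operators \<open>P t\<close> and the pairing
  \<open>ip\<close>\<close>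

sublocale pair_sigma_finite M M ..

lemma k_measurable'[measurable]: "t > 0 \<Longrightarrow> x \<in> space M \<Longrightarrow> k t x \<in> borel_measurable M"
  using measurable_compose[OF measurable_Pair1' k_measurable] by simp

lemma P_measurable[measurable (raw)]:
  assumes "t \<ge> 0" and [measurable]: "g \<in> borel_measurable M"
  shows "P t g \<in> borel_measurable M"
proof (cases "t = 0")
  case False
  then have [measurable]: "case_prod (k t) \<in> borel_measurable (M \<Otimes>\<^sub>M M)"
    using assms k_measurable by simp
  have "(\<lambda>x. \<integral>\<^sup>+y. case_prod (k t) (x, y) * g y \<partial>M) \<in> borel_measurable M"
    by measurable
  then show ?thesis using False by (simp add: P_def[abs_def])
qed (simp add: P_def[abs_def])

lemma P_0[simp]: "P 0 g = g"
  by (simp add: P_def[abs_def])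

lemma P_mono: "(\<And>y. y \<in> space M \<Longrightarrow> f y \<le> g y) \<Longrightarrow> x \<in> space M \<Longrightarrow> P t f x \<le> P t g x"
  by (auto simp: P_def intro!: nn_integral_mono mult_left_mono)

lemma P_sum:
  assumes "t \<ge> 0" "\<And>i. i \<in> I \<Longrightarrow> g i \<in> borel_measurable M" "x \<in> space M"
  shows "P t (\<lambda>y. \<Sum>i\<in>I. g i y) x = (\<Sum>i\<in>I. P t (g i) x)"
proof (cases "t = 0")
  case False
  then have "k t x \<in> borel_measurable M" using assms by auto
  with assms(2) False show ?thesis
    by (simp add: P_def sum_distrib_left nn_integral_sum)
qed simp

lemma P_add:
  assumes "t \<ge> 0" "f \<in> borel_measurable M" "g \<in> borel_measurable M" "x \<in> space M"
  shows "P t (\<lambda>y. f y + g y) x = P t f x + P t g x"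
  using P_sum[of t "UNIV :: bool set" "\<lambda>b. if b then f else g" x] assms by (simp add: UNIV_bool ac_simps)

lemma P_const: 
  assumes "t \<ge> 0" "x \<in> space M" shows "P t (\<lambda>_. c) x = c"
proof (cases "t = 0")
  case False
  then have "t > 0" using assms by simp
  with assms show ?thesis by (simp add: P_def nn_integral_multc k_one)
qed simp

lemma P_le_const:
  "t \<ge> 0 \<Longrightarrow> (\<And>y. y \<in> space M \<Longrightarrow> g y \<le> c) \<Longrightarrow> x \<in> space M \<Longrightarrow> P t g x \<le> c"
  using P_mono[of g "\<lambda>_. c" x t] by (simp add: P_const)

lemma P_P:
  assumes "s \<ge> 0" "t \<ge> 0" and [measurable]: "g \<in> borel_measurable M" and x: "x \<in> space M"
  shows "P s (P t g) x = P (s + t) g x"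
proof (cases "s = 0 \<or> t = 0")
  case False
  then have st: "s > 0" "t > 0" using assms by auto
  note [measurable] = k_measurable[OF st(2)] k_measurable'[OF st(1) x]
  have "P s (P t g) x = (\<integral>\<^sup>+y. \<integral>\<^sup>+z. k s x y * (k t y z * g z) \<partial>M \<partial>M)"
    using st by (auto simp: P_def nn_integral_cmult intro!: nn_integral_cong)
  also have "\<dots> = (\<integral>\<^sup>+z. \<integral>\<^sup>+y. k s x y * (k t y z * g z) \<partial>M \<partial>M)"
    by (rule Fubini') measurable
  also have "\<dots> = (\<integral>\<^sup>+z. (\<integral>\<^sup>+y. k s x y * k t y z \<partial>M) * g z \<partial>M)"
    by (intro nn_integral_cong, subst nn_integral_multc[symmetric]) (auto simp: ac_simps)
  also have "\<dots> = P (s + t) g x"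
    using st x by (auto simp: P_def k_add intro!: nn_integral_cong)
  finally show ?thesis .
qed (auto simp: P_def)

lemma ip_cong:
  "(\<And>x. x \<in> space M \<Longrightarrow> f x = f' x) \<Longrightarrow> (\<And>x. x \<in> space M \<Longrightarrow> g x = g' x) \<Longrightarrow> ip f g = ip f' g'"
  by (auto simp: ip_def intro!: nn_integral_cong)

lemma ip_mono:
  "(\<And>x. x \<in> space M \<Longrightarrow> f x \<le> f' x) \<Longrightarrow> (\<And>x. x \<in> space M \<Longrightarrow> g x \<le> g' x) \<Longrightarrow> ip f g \<le> ip f' g'"
  by (auto simp: ip_def intro!: nn_integral_mono mult_mono)

lemma ip_commute: "ip f g = ip g f"
  by (simp add: ip_def mult.commute)

lemma ip_self: "ip f f = sqnorm f"
  by (simp add: ip_def power2_eq_square)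

lemma ip_sum_left:
  assumes "\<And>i. i \<in> I \<Longrightarrow> f i \<in> borel_measurable M" "g \<in> borel_measurable M"
  shows "ip (\<lambda>x. \<Sum>i\<in>I. f i x) g = (\<Sum>i\<in>I. ip (f i) g)"
  unfolding ip_def sum_distrib_right using assms by (subst nn_integral_sum) auto

lemma ip_sum_right:
  assumes "\<And>i. i \<in> I \<Longrightarrow> f i \<in> borel_measurable M" "g \<in> borel_measurable M"
  shows "ip g (\<lambda>x. \<Sum>i\<in>I. f i x) = (\<Sum>i\<in>I. ip g (f i))"
  using ip_sum_left[OF assms] by (simp add: ip_commute)

lemma ip_P:
  assumes "t \<ge> 0" and [measurable]: "f \<in> borel_measurable M" "g \<in> borel_measurable M"
  shows "ip f (P t g) = ip (P t f) g"
proof (cases "t = 0")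
  case False
  then have t: "t > 0" using assms by auto
  note [measurable] = k_measurable[OF t] k_measurable'[OF t]
  have "ip f (P t g) = (\<integral>\<^sup>+x. \<integral>\<^sup>+y. f x * (k t x y * g y) \<partial>M \<partial>M)"
    using t by (auto simp: P_def ip_def nn_integral_cmult intro!: nn_integral_cong)
  also have "\<dots> = (\<integral>\<^sup>+y. \<integral>\<^sup>+x. f x * (k t x y * g y) \<partial>M \<partial>M)"
    by (rule Fubini') measurable
  also have "\<dots> = (\<integral>\<^sup>+y. \<integral>\<^sup>+x. (k t y x * f x) * g y \<partial>M \<partial>M)"
    using t by (auto simp: k_sym ac_simps intro!: nn_integral_cong)
  also have "\<dots> = ip (P t f) g"
    using t by (auto simp: P_def ip_def nn_integral_multc intro!: nn_integral_cong)
  finally show ?thesis .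
qed simp

section \<open>L2 estimates and the dual maximal inequality\<close>

lemma ip_le_squares:
  assumes [measurable]: "f \<in> borel_measurable M" "g \<in> borel_measurable M"
  shows "2 * ip f g \<le> sqnorm f + sqnorm g"
proof -
  have "2 * ip f g = (\<integral>\<^sup>+x. 2 * (f x * g x) \<partial>M)"
    by (simp add: ip_def nn_integral_cmult)
  also have "\<dots> \<le> (\<integral>\<^sup>+x. (f x)\<^sup>2 + (g x)\<^sup>2 \<partial>M)"
    by (intro nn_integral_mono ennreal_two_mult_le_squares)
  finally show ?thesis by (simp add: nn_integral_add)
qed

text \<open>Jensen's inequality for the probability measure with density \<open>k t x\<close>, in
  the form of Cauchy-Schwarz against the constant 1.\<close>

lemma P_square_le:
  assumes "t \<ge> 0" and [measurable]: "g \<in> borel_measurable M" and x: "x \<in> space M"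
  shows "(P t g x)\<^sup>2 \<le> P t (\<lambda>y. (g y)\<^sup>2) x"
proof (cases "t = 0")
  case False
  then have t: "t > 0" using assms by auto
  note [measurable] = k_measurable'[OF t x]
  let ?D = "density M (k t x)"
  have "(P t g x)\<^sup>2 = (\<integral>\<^sup>+y. 1 * g y \<partial>?D)\<^sup>2"
    using t by (simp add: P_def nn_integral_density)
  also have "\<dots> \<le> (\<integral>\<^sup>+y. 1\<^sup>2 \<partial>?D) * (\<integral>\<^sup>+y. (g y)\<^sup>2 \<partial>?D)"
    by (rule Cauchy_Schwarz_nn_integral) auto
  also have "\<dots> = P t (\<lambda>y. (g y)\<^sup>2) x"
    using t x by (simp add: P_def nn_integral_density emeasure_density k_one
        cong: nn_integral_cong)
  finally show ?thesis .
qed simp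

lemma sqnorm_P_le:
  assumes t: "t \<ge> 0" and g[measurable]: "g \<in> borel_measurable M"
  shows "sqnorm (P t g) \<le> sqnorm g"
proof -
  have "sqnorm (P t g) \<le> ip (\<lambda>_. 1) (P t (\<lambda>y. (g y)\<^sup>2))"
    by (auto simp: ip_def intro!: nn_integral_mono P_square_le t)
  also have "\<dots> = ip (P t (\<lambda>_. 1)) (\<lambda>y. (g y)\<^sup>2)"
    using t by (intro ip_P) auto
  also have "\<dots> = sqnorm g"
    using t by (auto simp: P_const ip_def intro!: nn_integral_cong)
  finally show ?thesis .
qed

text \<open>
  A finite form of Rota's dilation: the right-hand side is the second moment of
  \<open>\<Sum>i. E[g i (X 0) | X (s i / 2)]\<close> for the stationary Markov process \<open>X\<close>, and for \<open>c = 0\<close> the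
  left-hand side is that of its conditional expectation given \<open>X 0\<close>.
\<close>

lemma sqnorm_sum_le_max:
  assumes "finite I" "\<And>i. i \<in> I \<Longrightarrow> g i \<in> borel_measurable M" "0 \<le> c" "\<And>i. i \<in> I \<Longrightarrow> c \<le> s i"
  shows "sqnorm (\<lambda>x. \<Sum>i\<in>I. P (s i - c / 2) (g i) x) \<le>
    (\<Sum>i\<in>I. \<Sum>j\<in>I. ip (g i) (P (max (s i) (s j)) (g j)))"
  using assms
\<comment> \<open>The ranking by \<open>- s i\<close> makes the inserted index \<open>a\<close> the
  one with the smallest time, so that \<open>s a\<close> can serve as the new lower bound
  \<open>c\<close> in the induction hypothesis.\<close>
proof (induction I arbitrary: c rule: finite_ranking_induct[where f = "\<lambda>i. - s i"])
  case (insert a I)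
  show ?case
  proof (cases "a \<in> I")
    case True
    then have "insert a I = I" by auto
    show ?thesis
      unfolding \<open>insert a I = I\<close> by (rule insert.IH) (use insert.prems in auto)
  next
    case False
    define c' where "c' = s a"
    have c': "0 \<le> c'" "c \<le> c'" "\<And>i. i \<in> I \<Longrightarrow> c' \<le> s i"
      using insert.prems(2) insert.prems(3)[of a] insert.hyps by (auto simp: c'_def)
    have [measurable]: "\<And>i. i \<in> I \<Longrightarrow> g i \<in> borel_measurable M" "g a \<in> borel_measurable M"
      using insert.prems by auto
    have nn: "s i \<ge> 0" "s i - c' / 2 \<ge> 0" if "i \<in> I" for i
      using c'(1) c'(3)[OF that] by auto
    define Y where "Y = (\<lambda>x. \<Sum>i\<in>I. P (s i - c' / 2) (g i) x)"
    define G where "G = P (c' / 2) (g a)"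
    have [measurable]: "Y \<in> borel_measurable M" "G \<in> borel_measurable M"
      unfolding Y_def G_def using c' nn by (auto intro!: borel_measurable_sum P_measurable)
    have "(\<Sum>i\<in>insert a I. P (s i - c / 2) (g i) x) = P ((c' - c) / 2) (\<lambda>x. G x + Y x) x"
      if x: "x \<in> space M" for x
    proof -
      have "P ((c' - c) / 2) (\<lambda>x. G x + Y x) x =
          P ((c' - c) / 2) G x + (\<Sum>i\<in>I. P ((c' - c) / 2) (P (s i - c' / 2) (g i)) x)"
        using x c' nn unfolding Y_def by (subst P_add) (auto simp: P_sum)
      also have "P ((c' - c) / 2) G x = P (s a - c / 2) (g a) x"
        using x c' unfolding G_def by (subst P_P) (auto simp: c'_def diff_divide_distrib)
      also have "(\<Sum>i\<in>I. P ((c' - c) / 2) (P (s i - c' / 2) (g i)) x) = (\<Sum>i\<in>I. P (s i - c / 2) (g i) x)"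
        using x c' nn by (intro sum.cong refl, subst P_P) (auto simp: diff_divide_distrib)
      finally show ?thesis
        using insert.hyps False by simp
    qed
    then have "sqnorm (\<lambda>x. \<Sum>i\<in>insert a I. P (s i - c / 2) (g i) x) =
        sqnorm (P ((c' - c) / 2) (\<lambda>x. G x + Y x))"
      by (intro nn_integral_cong) auto
    also have "\<dots> \<le> sqnorm (\<lambda>x. G x + Y x)"
      using c' by (intro sqnorm_P_le) auto
    also have "\<dots> = (\<integral>\<^sup>+x. G x * G x + (G x * Y x + (Y x * G x + (Y x)\<^sup>2)) \<partial>M)"
      by (intro nn_integral_cong) (simp add: power2_eq_square algebra_simps)
    also have "\<dots> = ip G G + (ip G Y + (ip Y G + sqnorm Y))"
      unfolding ip_def by (simp add: nn_integral_add)
    also have "ip G G = ip (g a) (P (max (s a) (s a)) (g a))"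
    proof -
      have "ip G G = ip (g a) (P (c' / 2) (P (c' / 2) (g a)))"
        using c' unfolding G_def by (subst ip_P[symmetric]) auto
      also have "\<dots> = ip (g a) (P (max (s a) (s a)) (g a))"
        using c' by (intro ip_cong refl) (auto simp: P_P c'_def)
      finally show ?thesis .
    qed
    \<comment> \<open>Moving \<open>P (c' / 2)\<close> from \<open>G\<close> onto \<open>Y\<close>
      restores the full time \<open>s i\<close>, which is the maximum of \<open>s a\<close> and
      \<open>s i\<close>.\<close>
    also have GY: "ip G Y = (\<Sum>i\<in>I. ip (g a) (P (max (s a) (s i)) (g i)))"
    proof -
      have "ip G Y = (\<Sum>i\<in>I. ip G (P (s i - c' / 2) (g i)))"
        unfolding Y_def using nn by (intro ip_sum_right) auto
      also have "\<dots> = (\<Sum>i\<in>I. ip (g a) (P (c' / 2) (P (s i - c' / 2) (g i))))"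
        unfolding G_def using c' nn by (intro sum.cong refl, subst ip_P) auto
      also have "\<dots> = (\<Sum>i\<in>I. ip (g a) (P (max (s a) (s i)) (g i)))"
        using c' nn by (intro sum.cong ip_cong refl) (auto simp: P_P c'_def max_def)
      finally show ?thesis .
    qed
    also have "ip Y G = (\<Sum>i\<in>I. ip (g i) (P (max (s i) (s a)) (g a)))"
    proof -
      have "ip (g a) (P (max (s a) (s i)) (g i)) = ip (g i) (P (max (s i) (s a)) (g a))" if "i \<in> I" for i
        using that c' nn by (subst ip_commute, subst ip_P) (auto simp: max.commute le_max_iff_disj)
      then show ?thesis using GY by (subst ip_commute) simp
    qed
    also have "sqnorm Y \<le> (\<Sum>i\<in>I. \<Sum>j\<in>I. ip (g i) (P (max (s i) (s j)) (g j)))"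
      unfolding Y_def using c' insert.prems by (intro insert.IH) auto
    finally show ?thesis
      using False insert.hyps(1) by (auto simp: sum.distrib add_ac)
  qed
qed simp

text \<open>Dual form of Stein's maximal inequality on L2. Each maximum of \<open>s i\<close> and
  \<open>s j\<close> is one of the two, so the double sum of the preceding lemma is at most the sum
  of both choices. This equals twice the pairing of \<open>\<Sum>i\<in>I. g i\<close> with the
  left-hand function, and Young's inequality absorbs the latter.\<close>

lemma dual_maximal_inequality:
  assumes I: "finite I" and g[measurable]: "\<And>i. i \<in> I \<Longrightarrow> g i \<in> borel_measurable M"
    and s: "\<And>i. i \<in> I \<Longrightarrow> 0 \<le> s i"
    and fin: "\<And>i. i \<in> I \<Longrightarrow> sqnorm (g i) < \<infinity>"
  shows "sqnorm (\<lambda>x. \<Sum>i\<in>I. P (s i) (g i) x) \<le> 4 * sqnorm (\<lambda>x. \<Sum>i\<in>I. g i x)"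
proof -
  define V where "V = (\<lambda>x. \<Sum>i\<in>I. P (s i) (g i) x)"
  define A where "A = (\<lambda>x. \<Sum>i\<in>I. g i x)"
  have [measurable]: "V \<in> borel_measurable M" "A \<in> borel_measurable M"
    unfolding V_def A_def using s by (auto intro!: borel_measurable_sum P_measurable)
  have *: "sqnorm V \<le> (\<Sum>i\<in>I. \<Sum>j\<in>I. ip (g i) (P (max (s i) (s j)) (g j)))"
    using sqnorm_sum_le_max[OF I g, where c = 0 and s = s] s by (simp add: V_def)
  have fin': "ip (g i) (P t (g j)) < \<infinity>" if "i \<in> I" "j \<in> I" "t \<ge> 0" for i j t
  proof -
    have "2 * ip (g i) (P t (g j)) \<le> sqnorm (g i) + sqnorm (P t (g j))"
      using that by (intro ip_le_squares) auto
    also have "\<dots> \<le> sqnorm (g i) + sqnorm (g j)"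
      using that by (intro add_mono sqnorm_P_le) auto
    also have "\<dots> < \<infinity>" using fin that by auto
    finally show ?thesis by (auto simp: ennreal_mult_less_top)
  qed
  have finV: "sqnorm V < \<infinity>"
    by (rule le_less_trans[OF *]) (use I s fin' in \<open>auto simp: less_top[symmetric] max_def\<close>)
  have "(\<Sum>i\<in>I. \<Sum>j\<in>I. ip (g i) (P (max (s i) (s j)) (g j))) \<le>
      (\<Sum>i\<in>I. \<Sum>j\<in>I. ip (P (s i) (g i)) (g j) + ip (g i) (P (s j) (g j)))"
  proof (intro sum_mono)
    fix i j assume ij: "i \<in> I" "j \<in> I"
    show "ip (g i) (P (max (s i) (s j)) (g j)) \<le> ip (P (s i) (g i)) (g j) + ip (g i) (P (s j) (g j))"
    proof (cases "s i \<le> s j")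
      case False
      moreover have "ip (g i) (P (s i) (g j)) = ip (P (s i) (g i)) (g j)"
        using ij s by (intro ip_P) auto
      ultimately show ?thesis by simp
    qed simp
  qed
  also have "\<dots> = ip V A + ip A V"
  proof -
    have "ip V A = (\<Sum>i\<in>I. ip (P (s i) (g i)) A)"
      unfolding V_def using s by (intro ip_sum_left) auto
    also have "\<dots> = (\<Sum>i\<in>I. \<Sum>j\<in>I. ip (P (s i) (g i)) (g j))"
      unfolding A_def using s by (intro sum.cong refl ip_sum_right) auto
    finally have VA: "ip V A = (\<Sum>i\<in>I. \<Sum>j\<in>I. ip (P (s i) (g i)) (g j))" .
    have "ip A V = (\<Sum>i\<in>I. ip (g i) V)"
      unfolding A_def by (intro ip_sum_left) auto
    also have "\<dots> = (\<Sum>i\<in>I. \<Sum>j\<in>I. ip (g i) (P (s j) (g j)))"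
      unfolding V_def using s by (intro sum.cong refl ip_sum_right) auto
    finally show ?thesis by (simp add: VA sum.distrib)
  qed
  also have "\<dots> = 2 * ip A V"
    by (simp add: ip_commute mult_2)
  finally have **: "sqnorm V \<le> 2 * ip A V"
    using * by simp
  \<comment> \<open>With the factor 2 attached to \<open>A\<close>, Young's inequality returns
    \<open>sqnorm V\<close> once against twice on the left; one copy cancels because
    \<open>finV\<close> makes it finite.\<close>
  have "2 * sqnorm V \<le> 2 * ip (\<lambda>x. 2 * A x) V"
    using mult_left_mono[OF **, of 2] by (simp add: ip_def nn_integral_cmult mult.assoc)
  also have "\<dots> \<le> sqnorm (\<lambda>x. 2 * A x) + sqnorm V"
    by (intro ip_le_squares) auto
  also have "sqnorm (\<lambda>x. 2 * A x) = 4 * sqnorm A"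
    by (simp add: power_mult_distrib nn_integral_cmult)
  finally have "sqnorm V + sqnorm V \<le> sqnorm V + 4 * sqnorm A"
    by (simp only: mult_2 add.commute)
  then have "sqnorm V \<le> 4 * sqnorm A"
    using finV unfolding ennreal_add_left_cancel_le by auto
  then show ?thesis
    by (simp only: V_def A_def)
qed

text \<open>Factoring \<open>P (t j - t i)\<close> at time \<open>b\<close> and moving one factor by
  symmetry turns the double sum into a single pairing \<open>ip V W\<close>. The dual maximal
  inequality bounds both sides; the constant is its 4, halved by Young's inequality.\<close>

lemma cross_bound:
  assumes I: "finite I" "finite J"
    and g[measurable]: "\<And>i. i \<in> I \<union> J \<Longrightarrow> g i \<in> borel_measurable M"
    and fin: "\<And>i. i \<in> I \<union> J \<Longrightarrow> sqnorm (g i) < \<infinity>"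
    and t: "\<And>i. i \<in> I \<Longrightarrow> t i \<le> b" "\<And>j. j \<in> J \<Longrightarrow> b \<le> t j"
  shows "(\<Sum>i\<in>I. \<Sum>j\<in>J. ip (g i) (P (t j - t i) (g j))) \<le>
    2 * (sqnorm (\<lambda>x. \<Sum>i\<in>I. g i x) + sqnorm (\<lambda>x. \<Sum>j\<in>J. g j x))"
proof -
  define V where "V = (\<lambda>x. \<Sum>i\<in>I. P (b - t i) (g i) x)"
  define W where "W = (\<lambda>x. \<Sum>j\<in>J. P (t j - b) (g j) x)"
  have nn: "\<And>i. i \<in> I \<Longrightarrow> 0 \<le> b - t i" "\<And>j. j \<in> J \<Longrightarrow> 0 \<le> t j - b"
    using t by auto
  have [measurable]: "V \<in> borel_measurable M" "W \<in> borel_measurable M"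
    unfolding V_def W_def using nn g by (auto intro!: borel_measurable_sum P_measurable)
  have "(\<Sum>i\<in>I. \<Sum>j\<in>J. ip (g i) (P (t j - t i) (g j))) =
      (\<Sum>i\<in>I. \<Sum>j\<in>J. ip (P (b - t i) (g i)) (P (t j - b) (g j)))"
  proof (intro sum.cong refl)
    fix i j assume ij: "i \<in> I" "j \<in> J"
    have "ip (P (b - t i) (g i)) (P (t j - b) (g j)) = ip (g i) (P (b - t i) (P (t j - b) (g j)))"
      using ij nn by (subst ip_P) auto
    also have "\<dots> = ip (g i) (P (t j - t i) (g j))"
      using ij nn by (intro ip_cong refl) (auto simp: P_P)
    finally show "ip (g i) (P (t j - t i) (g j)) = ip (P (b - t i) (g i)) (P (t j - b) (g j))" ..
  qed
  also have "\<dots> = ip V W"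
  proof -
    have "ip V W = (\<Sum>i\<in>I. ip (P (b - t i) (g i)) W)"
      unfolding V_def using nn by (intro ip_sum_left) auto
    also have "\<dots> = (\<Sum>i\<in>I. \<Sum>j\<in>J. ip (P (b - t i) (g i)) (P (t j - b) (g j)))"
      unfolding W_def using nn by (intro sum.cong refl ip_sum_right) auto
    finally show ?thesis ..
  qed
  finally have eq: "(\<Sum>i\<in>I. \<Sum>j\<in>J. ip (g i) (P (t j - t i) (g j))) = ip V W" .
  have "2 * ip V W \<le> sqnorm V + sqnorm W"
    by (rule ip_le_squares) auto
  also have "\<dots> \<le> 4 * sqnorm (\<lambda>x. \<Sum>i\<in>I. g i x) + 4 * sqnorm (\<lambda>x. \<Sum>j\<in>J. g j x)"
    unfolding V_def W_def using I fin nn by (intro add_mono dual_maximal_inequality) auto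
  also have "\<dots> = 2 * (2 * (sqnorm (\<lambda>x. \<Sum>i\<in>I. g i x) + sqnorm (\<lambda>x. \<Sum>j\<in>J. g j x)))"
    by (simp add: distrib_left mult.assoc[symmetric])
  finally show ?thesis
    unfolding eq by (subst (asm) ennreal_mult_le_mult_iff) auto
qed

end

section \<open>Energy of disjoint sets\<close>

definition triangle_sum :: "(nat \<Rightarrow> nat \<Rightarrow> ennreal) \<Rightarrow> nat set \<Rightarrow> ennreal" where
  "triangle_sum K I = (\<Sum>i\<in>I. \<Sum>j\<in>I. if i \<le> j then K i j else 0)"

lemma triangle_sum_split:
  assumes "a \<le> b" "b \<le> c"
  shows "triangle_sum K {a..<c} =
    triangle_sum K {a..<b} + triangle_sum K {b..<c} + (\<Sum>i\<in>{a..<b}. \<Sum>j\<in>{b..<c}. K i j)"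
proof -
  have *: "(\<Sum>i\<in>{a..<c}. f i) = (\<Sum>i\<in>{a..<b}. f i) + (\<Sum>i\<in>{b..<c}. f i)" for f :: "nat \<Rightarrow> ennreal"
    using assms by (simp add: sum.atLeastLessThan_concat)
  have "(\<Sum>i\<in>{a..<b}. \<Sum>j\<in>{b..<c}. if i \<le> j then K i j else 0) = (\<Sum>i\<in>{a..<b}. \<Sum>j\<in>{b..<c}. K i j)"
    by (intro sum.cong refl) auto
  moreover have "(\<Sum>i\<in>{b..<c}. \<Sum>j\<in>{a..<b}. if i \<le> j then K i j else 0) = 0"
    by (intro sum.neutral ballI) auto
  ultimately show ?thesis
    unfolding triangle_sum_def * sum.distrib by (simp add: add_ac)
qed

lemma of_nat_sum_mult:
  "of_nat a * u + of_nat b * u = (of_nat (a + b) * u :: 'a :: semiring_1)"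
  by (simp add: distrib_right)

text \<open>Halving the interval \<open>l\<close> times, the pairs separated at each level cost
  twice the total mass by \<open>cross\<close>; the diagonal left at the end costs it once.\<close>

lemma triangle_sum_dyadic:
  assumes diag: "\<And>i. K i i \<le> m i"
    and cross: "\<And>a b c. a \<le> b \<Longrightarrow> b \<le> c \<Longrightarrow>
      (\<Sum>i\<in>{a..<b}. \<Sum>j\<in>{b..<c}. K i j) \<le> 2 * (\<Sum>i\<in>{a..<c}. m i)"
  shows "triangle_sum K {a..<a + 2 ^ l} \<le> of_nat (1 + 2 * l) * (\<Sum>i\<in>{a..<a + 2 ^ l}. m i)"
proof (induction l arbitrary: a)
  case 0
  then show ?case using diag by (simp add: triangle_sum_def)
next
  case (Suc l)
  define b where "b = a + 2 ^ l"
  have c: "a + 2 ^ Suc l = b + 2 ^ l" by (simp add: b_def)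
  let ?m = "\<lambda>I. \<Sum>i\<in>I. m i"
  have m: "?m {a..<b + 2 ^ l} = ?m {a..<b} + ?m {b..<b + 2 ^ l}"
    by (simp add: sum.atLeastLessThan_concat b_def)
  have "triangle_sum K {a..<b + 2 ^ l} \<le>
      of_nat (1 + 2 * l) * ?m {a..<b} + of_nat (1 + 2 * l) * ?m {b..<b + 2 ^ l} +
        of_nat 2 * ?m {a..<b + 2 ^ l}"
    using Suc.IH[of a] Suc.IH[of b]
    by (subst triangle_sum_split[of a b]) (auto simp: b_def intro!: add_mono cross)
  also have "\<dots> = of_nat (1 + 2 * Suc l) * ?m {a..<b + 2 ^ l}"
    unfolding m distrib_left[symmetric] of_nat_sum_mult by simp
  finally show ?case by (simp only: c)
qed

text \<open>Cut into blocks of length \<open>2 ^ l\<close>. Pairs within a block are summed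
  dyadically, pairs in adjacent blocks fall under \<open>cross\<close>, and all other pairs are at
  distance at least \<open>2 ^ l\<close> and fall under \<open>far\<close>.\<close>

lemma triangle_sum_blocks:
  assumes diag: "\<And>i. K i i \<le> m i"
    and cross: "\<And>a b c. a \<le> b \<Longrightarrow> b \<le> c \<Longrightarrow>
      (\<Sum>i\<in>{a..<b}. \<Sum>j\<in>{b..<c}. K i j) \<le> 2 * (\<Sum>i\<in>{a..<c}. m i)"
    and far: "\<And>b j. b + 2 ^ l \<le> j \<Longrightarrow> (\<Sum>i<b. K i j) \<le> of_nat D * m j"
  shows "triangle_sum K {..<q * 2 ^ l} \<le> of_nat (5 + 2 * l + D) * (\<Sum>i<q * 2 ^ l. m i)"
proof -
  define N :: nat where "N = 2 ^ l"
  let ?m = "\<lambda>I. \<Sum>i\<in>I. m i"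
  \<comment> \<open>The additional term prepays the share of the last block in its interaction with
    the next one. A block thus pays \<open>1 + 2 * l\<close> internally, \<open>D\<close> for
    distant blocks, 2 for its predecessor and 2 in advance for its successor:
    \<open>5 + 2 * l + D\<close> in all.\<close>
  have "triangle_sum K {0..<q * N} + 2 * ?m {(q - 1) * N..<q * N} \<le> of_nat (5 + 2 * l + D) * ?m {0..<q * N}"
  proof (induction q)
    case 0
    show ?case by (simp add: triangle_sum_def)
  next
    case (Suc q)
    \<comment> \<open>For \<open>q = 0\<close> truncated subtraction gives \<open>a = b = 0\<close>,
      so that the previous block is empty.\<close>
    define a b c where "a = (q - 1) * N" and "b = q * N" and "c = Suc q * N"
    have abc: "a \<le> b" "b \<le> c" "c = b + N" "q > 0 \<Longrightarrow> a + N = b"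
      by (auto simp: a_def b_def c_def diff_mult_distrib algebra_simps)
    have "(\<Sum>i\<in>{0..<a}. \<Sum>j\<in>{b..<c}. K i j) \<le> of_nat D * ?m {b..<c}"
    proof (cases "q = 0")
      case False
      have "(\<Sum>i\<in>{0..<a}. \<Sum>j\<in>{b..<c}. K i j) = (\<Sum>j\<in>{b..<c}. \<Sum>i<a. K i j)"
        by (subst sum.swap) (simp add: atLeast0LessThan)
      also have "\<dots> \<le> (\<Sum>j\<in>{b..<c}. of_nat D * m j)"
        using abc False by (intro sum_mono far) (auto simp: N_def)
      finally show ?thesis by (simp add: sum_distrib_left)
    qed (simp add: a_def)
    moreover have "(\<Sum>i\<in>{a..<b}. \<Sum>j\<in>{b..<c}. K i j) \<le> 2 * ?m {a..<b} + 2 * ?m {b..<c}"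
      using cross[OF abc(1,2)] sum.atLeastLessThan_concat[OF abc(1,2), of m]
      by (metis distrib_left)
    ultimately have x: "(\<Sum>i\<in>{0..<b}. \<Sum>j\<in>{b..<c}. K i j) \<le>
        of_nat D * ?m {b..<c} + (2 * ?m {a..<b} + 2 * ?m {b..<c})"
      using sum.atLeastLessThan_concat[OF le0 abc(1), of "\<lambda>i. \<Sum>j\<in>{b..<c}. K i j"]
      by (metis add_mono)
    have d: "triangle_sum K {b..<c} \<le> of_nat (1 + 2 * l) * ?m {b..<c}"
      using triangle_sum_dyadic[OF diag cross, of b l] by (simp add: abc(3) N_def)
    have "triangle_sum K {0..<c} + 2 * ?m {b..<c} \<le> 
        (triangle_sum K {0..<b} + of_nat (1 + 2 * l) * ?m {b..<c} +
          (of_nat D * ?m {b..<c} + (2 * ?m {a..<b} + 2 * ?m {b..<c}))) + 2 * ?m {b..<c}"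
      unfolding triangle_sum_split[OF le0 abc(2)] by (intro add_mono x d order_refl)
    also have "\<dots> = (triangle_sum K {0..<b} + 2 * ?m {a..<b}) +
        (of_nat (1 + 2 * l) * ?m {b..<c} + of_nat D * ?m {b..<c} + of_nat 2 * ?m {b..<c} + of_nat 2 * ?m {b..<c})"
      unfolding of_nat_numeral by (simp only: add_ac)
    also have "\<dots> = (triangle_sum K {0..<b} + 2 * ?m {a..<b}) + of_nat (5 + 2 * l + D) * ?m {b..<c}"
    proof -
      have "1 + 2 * l + D + 2 + 2 = 5 + 2 * l + D" by simp
      then show ?thesis unfolding of_nat_sum_mult by (simp only:)
    qed
    also have "\<dots> \<le> of_nat (5 + 2 * l + D) * ?m {0..<b} + of_nat (5 + 2 * l + D) * ?m {b..<c}"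
      using Suc.IH unfolding a_def b_def by (intro add_mono order_refl) auto
    also have "\<dots> = of_nat (5 + 2 * l + D) * ?m {0..<c}"
      using sum.atLeastLessThan_concat[OF le0 abc(2), of m] by (simp only: distrib_left[symmetric])
    finally show ?case by (simp add: b_def c_def)
  qed
  then have "triangle_sum K {0..<q * N} \<le> of_nat (5 + 2 * l + D) * ?m {0..<q * N}"
    by (rule order_trans[rotated]) simp
  then show ?thesis by (simp add: N_def atLeast0LessThan)
qed

section \<open>The energy bound for disjoint sets\<close>

context symmetric_markov_kernels begin

lemma sqnorm_indicator_UN:
  assumes "finite I" "disjoint_family F" "\<And>i. F i \<in> sets M"
  shows "sqnorm (\<lambda>x. \<Sum>i\<in>I. indicator (F i) x) = (\<Sum>i\<in>I. emeasure M (F i))"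
proof -
  have d: "disjoint_family_on F I"
    using assms(2) by (rule disjoint_family_on_mono[rotated]) simp
  have "(\<Sum>i\<in>I. indicator (F i) x)\<^sup>2 = (indicator (\<Union>i\<in>I. F i) x :: ennreal)" for x
    unfolding indicator_UN_disjoint[OF assms(1) d, symmetric] by (simp add: indicator_def)
  then have "sqnorm (\<lambda>x. \<Sum>i\<in>I. indicator (F i) x) = emeasure M (\<Union>i\<in>I. F i)"
    using assms(1,3) by (simp add: sets.finite_UN)
  also have "\<dots> = (\<Sum>i\<in>I. emeasure M (F i))"
    using assms d by (subst sum_emeasure) auto
  finally show ?thesis .
qed

lemma ip_indicator: "F \<in> sets M \<Longrightarrow> ip (indicator F) (\<lambda>_. c) = c * emeasure M F"
  by (simp add: ip_def mult.commute nn_integral_cmult_indicator)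

text \<open>Sums of indicators of disjoint sets are again indicators, so their squared L2 norms are
  measures, additive over the index. This turns \<open>cross_bound\<close> into the hypothesis
  \<open>cross\<close> of the block summation.\<close>

lemma triangle_sum_indicator_le:
  fixes t :: "nat \<Rightarrow> real" and F :: "nat \<Rightarrow> 'a set"
  assumes t: "mono t" "0 \<le> t 0"
    and far: "\<And>i j g x. i + 2 ^ l \<le> j \<Longrightarrow> g \<in> borel_measurable M \<Longrightarrow> x \<in> space M \<Longrightarrow>
      P (t j - t i) g x \<le> of_nat D * P (t j) g x"
    and F: "disjoint_family F" "\<And>i. F i \<in> sets M" "\<And>i. emeasure M (F i) < \<infinity>"
  shows "triangle_sum (\<lambda>i j. ip (indicator (F i)) (P (t j - t i) (indicator (F j)))) {..<q * 2 ^ l} \<le>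
    of_nat (5 + 2 * l + D) * (\<Sum>i<q * 2 ^ l. emeasure M (F i))"
proof (rule triangle_sum_blocks)
  have ind2: "sqnorm (indicator (F i)) = emeasure M (F i)" for i
    using sqnorm_indicator_UN[OF _ F(1,2), of "{i}"] by simp
  have nn: "0 \<le> t i" for i
    using t monoD[OF t(1), of 0 i] by simp
  have [measurable]: "F i \<in> sets M" for i by fact
  show "ip (indicator (F i)) (P (t i - t i) (indicator (F i))) \<le> emeasure M (F i)" for i
    by (simp add: ip_self ind2)
  show "(\<Sum>i\<in>{a..<b}. \<Sum>j\<in>{b..<c}. ip (indicator (F i)) (P (t j - t i) (indicator (F j)))) \<le>
      2 * (\<Sum>i\<in>{a..<c}. emeasure M (F i))" if "a \<le> b" "b \<le> c" for a b c
  proof -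
    have "(\<Sum>i\<in>{a..<b}. \<Sum>j\<in>{b..<c}. ip (indicator (F i)) (P (t j - t i) (indicator (F j)))) \<le>
      2 * (sqnorm (\<lambda>x. \<Sum>i\<in>{a..<b}. indicator (F i) x) + sqnorm (\<lambda>x. \<Sum>i\<in>{b..<c}. indicator (F i) x))"
      using F(3) t(1) by (intro cross_bound[where b = "t b"]) (auto simp: ind2 monoD)
    also have "\<dots> = 2 * (\<Sum>i\<in>{a..<c}. emeasure M (F i))"
      using F that by (simp add: sqnorm_indicator_UN sum.atLeastLessThan_concat)
    finally show ?thesis .
  qed
  show "(\<Sum>i<b. ip (indicator (F i)) (P (t j - t i) (indicator (F j)))) \<le> of_nat D * emeasure M (F j)"
    if bj: "b + 2 ^ l \<le> j" for b j
  proof -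
    \<comment> \<open>After \<open>far\<close> all terms involve the same operator
      \<open>P (t j)\<close>, so the sum over \<open>i\<close> moves inside it. There it is a sum of
      disjoint indicators, at most 1, and \<open>P (t j)\<close> keeps this bound.\<close>
    have "(\<Sum>i<b. ip (indicator (F i)) (P (t j - t i) (indicator (F j)))) \<le>
        (\<Sum>i<b. ip (indicator (F j)) (\<lambda>x. of_nat D * P (t j) (indicator (F i)) x))"
    proof (intro sum_mono)
      fix i assume "i \<in> {..<b}"
      then have i: "i + 2 ^ l \<le> j" "t i \<le> t j"
        using bj monoD[OF t(1), of i j] by auto
      then show "ip (indicator (F i)) (P (t j - t i) (indicator (F j))) \<le>
          ip (indicator (F j)) (\<lambda>x. of_nat D * P (t j) (indicator (F i)) x)"
        by (subst ip_P, simp, simp, simp, subst ip_commute) (intro ip_mono far, auto)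
    qed
    also have "\<dots> = ip (indicator (F j)) (\<lambda>x. of_nat D * P (t j) (\<lambda>x. \<Sum>i<b. indicator (F i) x) x)"
      using nn by (subst ip_sum_right[symmetric])
        (auto simp: P_sum sum_distrib_left intro!: ip_cong)
    also have "\<dots> \<le> ip (indicator (F j)) (\<lambda>x. of_nat D * 1)"
    proof (intro ip_mono mult_left_mono P_le_const nn)
      have d: "disjoint_family_on F {..<b}"
        using F(1) by (rule disjoint_family_on_mono[rotated]) simp
      show "(\<Sum>i<b. indicator (F i) y) \<le> (1::ennreal)" for y
        unfolding indicator_UN_disjoint[OF finite_lessThan d, symmetric] by (simp add: indicator_def)
    qed auto
    finally show ?thesis by (simp add: ip_indicator)
  qed
qed

section \<open>From potentials to the weak type bound for a sequence of times\<close>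

text \<open>Downward induction from the empty sum at \<open>K\<close>. Off \<open>G i\<close> the
  term with \<open>j = i\<close> vanishes, so \<open>W i\<close> is the average
  \<open>P (t (Suc i) - t i)\<close> of \<open>W (Suc i)\<close> and inherits its bound.\<close>

lemma maximum_principle:
  fixes t :: "nat \<Rightarrow> real" and G :: "nat \<Rightarrow> 'a set" and K :: nat
  defines "W \<equiv> \<lambda>i x. \<Sum>j\<in>{i..<K}. P (t j - t i) (indicator (G j)) x"
  assumes t: "mono t" and G[measurable]: "\<And>i. G i \<in> sets M"
    and le: "\<And>i x. i < K \<Longrightarrow> x \<in> G i \<Longrightarrow> W i x \<le> L"
    and "i \<le> K" "x \<in> space M"
  shows "W i x \<le> L"
  using assms(5,6)
proof (induction i arbitrary: x rule: inc_induct)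
  case (step i)
  show ?case
  proof (cases "x \<in> G i")
    case False
    have nn: "0 \<le> t j - t i" if "i \<le> j" for i j using monoD[OF t that] by simp
    have "W i x = (\<Sum>j\<in>{Suc i..<K}. P (t j - t i) (indicator (G j)) x)"
      unfolding W_def using step.hyps False by (subst sum.atLeast_Suc_lessThan) auto
    also have "\<dots> = (\<Sum>j\<in>{Suc i..<K}. P (t (Suc i) - t i) (P (t j - t (Suc i)) (indicator (G j))) x)"
      using step.prems nn by (intro sum.cong refl, subst P_P) auto
    also have "\<dots> = P (t (Suc i) - t i) (W (Suc i)) x"
      unfolding W_def using step.prems nn by (subst P_sum) auto
    also have "\<dots> \<le> L"
      using nn step by (intro P_le_const) auto
    finally show ?thesis .
  qed (use le step in auto)
qed (simp add: W_def)

text \<open>The factor 4 is a product of two twos: up to half of the measure is discarded, and the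
  potential of what remains is at most twice the energy constant
  \<open>5 + 2 * l + D\<close>.\<close>

theorem weak_type_maximal:
  fixes t :: "nat \<Rightarrow> real"
  assumes t: "mono t" "0 \<le> t 0"
    and far: "\<And>i j g x. i + 2 ^ l \<le> j \<Longrightarrow> g \<in> borel_measurable M \<Longrightarrow> x \<in> space M \<Longrightarrow>
      P (t j - t i) g x \<le> of_nat D * P (t j) g x"
    and \<phi>[measurable]: "\<phi> \<in> borel_measurable M" and fin: "(\<integral>\<^sup>+x. \<phi> x \<partial>M) < \<infinity>" 
    and \<beta>: "0 < \<beta>" "\<beta> < \<infinity>"
  shows "\<beta> * emeasure M (\<Union>i<n. {x \<in> space M. \<beta> < P (t i) \<phi> x}) \<le>
    4 * of_nat (5 + 2 * l + D) * (\<integral>\<^sup>+x. \<phi> x \<partial>M)"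
proof -
  define A where "A i = {x \<in> space M. \<beta> < P (t i) \<phi> x}" for i
  define F where "F = disjointed A"
  \<comment> \<open>The number of times is raised to a multiple of the block length; more times only
    enlarge the union.\<close>
  define K where "K = n * 2 ^ l"
  define c :: ennreal where "c = of_nat (5 + 2 * l + D)"
  have "c < \<infinity>"
    unfolding c_def infinity_ennreal_def by (rule of_nat_less_top)
  then have c: "c \<noteq> 0" "c < \<infinity>"
    unfolding c_def by auto
  have nn: "0 \<le> t i" for i
    using t monoD[OF t(1), of 0 i] by simp
  have nn': "0 \<le> t j - t i" if "i \<le> j" for i j using monoD[OF t(1) that] by simp
  have A[measurable]: "A i \<in> sets M" for i unfolding A_def using nn by measurable
  have F[measurable]: "F i \<in> sets M" for i
    using sets.range_disjointed_sets[of A M] A unfolding F_def by blast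
  have FA: "F i \<subseteq> A i" for i unfolding F_def by (rule disjointed_subset)
  have disj: "disjoint_family F" unfolding F_def by (rule disjoint_family_disjointed)
  have big: "\<beta> * emeasure M G \<le> ip (P (t i) (indicator G)) \<phi>" if [measurable]: "G \<in> sets M" and "G \<subseteq> F i" for G i
  proof -
    have "\<beta> * emeasure M G = ip (indicator G) (\<lambda>_. \<beta>)"
      by (simp add: ip_indicator)
    also have "\<dots> \<le> ip (indicator G) (P (t i) \<phi>)"
      unfolding ip_def using that(2) FA[of i] by (intro nn_integral_mono) (auto simp: A_def indicator_def)
    also have "\<dots> = ip (P (t i) (indicator G)) \<phi>"
      using nn by (intro ip_P) auto
    finally show ?thesis .
  qed
  \<comment> \<open>Since \<open>P (t i)\<close> of an indicator is at most 1, \<open>big\<close>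
    yields Chebyshev's inequality at a single time. Finiteness permits the L2 estimates and the
    cancellations in \<open>ennreal\<close>.\<close>
  have finF: "emeasure M (F i) < \<infinity>" for i
  proof -
    have "\<beta> * emeasure M (F i) \<le> ip (\<lambda>_. 1) \<phi>"
      by (rule order_trans[OF big[of "F i" i]])
        (auto intro!: ip_mono P_le_const nn simp: indicator_def)
    also have "\<dots> < \<infinity>" using fin by (simp add: ip_def)
    finally show ?thesis using \<beta> by (auto simp: ennreal_mult_less_top)
  qed
  define W where "W G i x = (\<Sum>j\<in>{i..<K}. P (t j - t i) (indicator (G j)) x)" for G :: "nat \<Rightarrow> 'a set" and i x
  have W[measurable]: "W G i \<in> borel_measurable M" if "\<And>j. G j \<in> sets M" for G i
    unfolding W_def[abs_def] using nn' that by (auto intro!: borel_measurable_sum P_measurable)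
  \<comment> \<open>The energy is at most \<open>c\<close> times the measure of the
    \<open>F i\<close>. By Markov's inequality with threshold \<open>2 * c\<close>, the exceptional
    sets \<open>B i\<close> carry at most half of this measure.\<close>
  define F' where "F' i = {x \<in> space M. x \<in> F i \<and> W F i x \<le> 2 * c}" for i
  define B where "B i = {x \<in> space M. x \<in> F i \<and> \<not> W F i x \<le> 2 * c}" for i
  have [measurable]: "W F i \<in> borel_measurable M" for i by (rule W) (rule F)
  have [measurable]: "F' i \<in> sets M" "B i \<in> sets M" for i
    unfolding F'_def B_def by measurable
  have FB: "emeasure M (F i) = emeasure M (F' i) + emeasure M (B i)" for i
  proof -
    have "F i = F' i \<union> B i" "F' i \<inter> B i = {}"
      using sets.sets_into_space[OF F[of i]] by (auto simp: F'_def B_def)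
    then show ?thesis by (metis plus_emeasure \<open>F' i \<in> sets M\<close> \<open>B i \<in> sets M\<close>)
  qed
  have "(2 * c) * (\<Sum>i<K. emeasure M (B i)) \<le> (\<Sum>i<K. ip (indicator (F i)) (W F i))"
    unfolding sum_distrib_left
  proof (intro sum_mono)
    fix i
    have "2 * c * emeasure M (B i) = ip (indicator (B i)) (\<lambda>_. 2 * c)"
      by (simp add: ip_indicator)
    also have "\<dots> \<le> ip (indicator (F i)) (W F i)"
      unfolding ip_def by (intro nn_integral_mono) (auto simp: B_def indicator_def)
    finally show "2 * c * emeasure M (B i) \<le> ip (indicator (F i)) (W F i)" .
  qed
  also have "\<dots> = triangle_sum (\<lambda>i j. ip (indicator (F i)) (P (t j - t i) (indicator (F j)))) {..<K}"
    unfolding triangle_sum_def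
  proof (intro sum.cong refl)
    fix i assume "i \<in> {..<K}"
    have "ip (indicator (F i)) (W F i) = (\<Sum>j\<in>{i..<K}. ip (indicator (F i)) (P (t j - t i) (indicator (F j))))"
      unfolding W_def[abs_def] using nn' by (intro ip_sum_right) auto
    also have "\<dots> = (\<Sum>j<K. if i \<le> j then ip (indicator (F i)) (P (t j - t i) (indicator (F j))) else 0)"
      by (rule sum.mono_neutral_cong_left) auto
    finally show "ip (indicator (F i)) (W F i) =
      (\<Sum>j<K. if i \<le> j then ip (indicator (F i)) (P (t j - t i) (indicator (F j))) else 0)" .
  qed
  also have "\<dots> \<le> c * (\<Sum>i<K. emeasure M (F i))"
    unfolding K_def c_def by (intro triangle_sum_indicator_le t far disj F finF)
  finally have "c * (2 * (\<Sum>i<K. emeasure M (B i))) \<le> c * (\<Sum>i<K. emeasure M (F i))"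
    by (simp add: mult_ac)
  then have "2 * (\<Sum>i<K. emeasure M (B i)) \<le> (\<Sum>i<K. emeasure M (F i))"
    using c by (subst (asm) ennreal_mult_le_mult_iff) auto
  also have "\<dots> = (\<Sum>i<K. emeasure M (B i)) + (\<Sum>i<K. emeasure M (F' i))"
    by (simp add: FB sum.distrib add.commute)
  finally have "(\<Sum>i<K. emeasure M (B i)) + (\<Sum>i<K. emeasure M (B i)) \<le>
      (\<Sum>i<K. emeasure M (B i)) + (\<Sum>i<K. emeasure M (F' i))"
    by (simp only: mult_2)
  moreover have "emeasure M (B i) \<noteq> \<infinity>" for i
    using finF[of i] unfolding FB[of i] by auto
  ultimately have "(\<Sum>i<K. emeasure M (B i)) \<le> (\<Sum>i<K. emeasure M (F' i))"
    unfolding ennreal_add_left_cancel_le by auto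
  then have half: "(\<Sum>i<K. emeasure M (F i)) \<le> 2 * (\<Sum>i<K. emeasure M (F' i))"
    by (simp add: FB sum.distrib mult_2)
  have sub: "F' i \<subseteq> F i" for i by (auto simp: F'_def)
  \<comment> \<open>Shrinking the sets shrinks the potential, so
    \<open>W F' i \<le> W F i \<le> 2 * c\<close> on \<open>F' i\<close>, which is what the maximum
    principle asks for.\<close>
  have WF': "W F' i x \<le> 2 * c" if "i \<le> K" "x \<in> space M" for i x
    unfolding W_def
  proof (rule maximum_principle[OF t(1) _ _ that])
    fix i x assume "x \<in> F' i"
    then have "x \<in> space M" "W F i x \<le> 2 * c" by (auto simp: F'_def)
    moreover have "(\<Sum>j\<in>{i..<K}. P (t j - t i) (indicator (F' j)) x) \<le> W F i x"
      unfolding W_def using sub \<open>x \<in> space M\<close> 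
      by (intro sum_mono P_mono) (auto simp: indicator_def)
    ultimately show "(\<Sum>j\<in>{i..<K}. P (t j - t i) (indicator (F' j)) x) \<le> 2 * c" by simp
  qed simp
  have "\<beta> * (\<Sum>i<K. emeasure M (F' i)) \<le> (\<Sum>i<K. ip (P (t i) (indicator (F' i))) \<phi>)"
    unfolding sum_distrib_left by (intro sum_mono big sub) auto
  also have "\<dots> = ip (\<lambda>x. \<Sum>i<K. P (t i) (indicator (F' i)) x) \<phi>"
    using nn by (intro ip_sum_left[symmetric]) auto
  \<comment> \<open>By the semigroup law the whole sum is an average of the potential at index 0,
    hence bounded by \<open>2 * c\<close>.\<close>
  also have "\<dots> = ip (P (t 0) (W F' 0)) \<phi>"
    unfolding W_def[abs_def] using nn nn'
    by (intro ip_cong refl, subst P_sum) (auto simp: P_P atLeast0LessThan)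
  also have "\<dots> \<le> ip (\<lambda>_. 2 * c) \<phi>"
    using nn WF' by (intro ip_mono P_le_const) auto
  also have "\<dots> = 2 * c * (\<integral>\<^sup>+x. \<phi> x \<partial>M)"
    by (simp add: ip_def nn_integral_cmult)
  finally have F': "\<beta> * (\<Sum>i<K. emeasure M (F' i)) \<le> 2 * c * (\<integral>\<^sup>+x. \<phi> x \<partial>M)" .
  have "n \<le> K" unfolding K_def by simp
  then have "(\<Union>i<n. A i) \<subseteq> (\<Union>i<K. A i)" by (intro UN_mono) auto
  also have "\<dots> = (\<Union>i<K. F i)"
    unfolding F_def by (simp add: UN_disjointed_eq finite_UN_disjointed_eq lessThan_atLeast0)
  finally have "emeasure M (\<Union>i<n. A i) \<le> emeasure M (\<Union>i<K. F i)"
    by (intro emeasure_mono) auto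
  also have "\<dots> \<le> (\<Sum>i<K. emeasure M (F i))"
    by (rule emeasure_subadditive_finite) auto
  also note half
  finally have "\<beta> * emeasure M (\<Union>i<n. A i) \<le> \<beta> * (2 * (\<Sum>i<K. emeasure M (F' i)))"
    by (rule mult_left_mono) simp
  also have "\<dots> = 2 * (\<beta> * (\<Sum>i<K. emeasure M (F' i)))"
    by (rule mult.left_commute)
  also have "\<dots> \<le> 2 * (2 * c * (\<integral>\<^sup>+x. \<phi> x \<partial>M))"
    by (intro mult_left_mono F') simp
  finally show ?thesis
    by (simp add: A_def c_def mult.assoc[symmetric])
qed

end

section \<open>The heat semigroup\<close>

text \<open>The heat kernel as a product of one-dimensional normal densities of variance
  \<open>2 * t\<close>: mass one and the convolution law then factor over the coordinates.\<close>

definition gauss_kernel :: "nat \<Rightarrow> real \<Rightarrow> (nat \<Rightarrow> real) \<Rightarrow> (nat \<Rightarrow> real) \<Rightarrow> ennreal" where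
  "gauss_kernel n t x y = (\<Prod>i<n. ennreal (normal_density 0 (sqrt (2 * t)) (x i - y i)))"

lemma heat_kernel_eq_prod:
  assumes "t > 0"
  shows "heat_kernel n t z = (\<Prod>i<n. normal_density 0 (sqrt (2 * t)) (z i))"
proof -
  have "(\<Prod>i<n. normal_density 0 (sqrt (2 * t)) (z i)) =
      (1 / sqrt (4 * pi * t)) ^ n * (\<Prod>i<n. exp (- (z i)\<^sup>2 / (4 * t)))"
    using assms by (simp add: normal_density_def prod.distrib prod_dividef power_one_over power_divide mult_ac)
  also have "(\<Prod>i<n. exp (- (z i)\<^sup>2 / (4 * t))) = exp (- (\<Sum>i<n. (z i)\<^sup>2) / (4 * t))"
    by (simp add: exp_sum[symmetric] sum_negf sum_divide_distrib)
  also have "(1 / sqrt (4 * pi * t)) ^ n = (4 * pi * t) powr (- real n / 2)"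
    using assms
    by (simp add: powr_half_sqrt[symmetric] powr_minus_divide[symmetric] powr_power power_one_over[symmetric])
  finally show ?thesis
    by (simp add: heat_kernel_def)
qed

lemma gauss_kernel_eq_heat_kernel:
  "t > 0 \<Longrightarrow> gauss_kernel n t x y = ennreal (heat_kernel n t (\<lambda>i\<in>{..<n}. x i - y i))"
  by (simp add: heat_kernel_eq_prod gauss_kernel_def prod_ennreal)

lemma nn_integral_normal_density:
  assumes "\<sigma> > 0" shows "(\<integral>\<^sup>+x. ennreal (normal_density \<mu> \<sigma> x) \<partial>lborel) = 1"
  using assms by (subst nn_integral_eq_integral) auto

lemma nn_integral_normal_density_shift:
  assumes "\<sigma> > 0" shows "(\<integral>\<^sup>+y. ennreal (normal_density 0 \<sigma> (x - y)) \<partial>lborel) = 1"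
proof -
  have "normal_density 0 \<sigma> (x - y) = normal_density x \<sigma> y" for y
    by (simp add: normal_density_def power2_commute)
  then show ?thesis using nn_integral_normal_density[OF assms] by simp
qed

lemma normal_density_convolution:
  assumes "s > 0" "t > 0"
  shows "(\<integral>\<^sup>+y. ennreal (normal_density 0 (sqrt s) (x - y)) * ennreal (normal_density 0 (sqrt t) (y - z)) \<partial>lborel) =
    ennreal (normal_density 0 (sqrt (s + t)) (x - z))"
proof -
  have "(\<integral>\<^sup>+y. ennreal (normal_density 0 (sqrt s) (x - y)) * ennreal (normal_density 0 (sqrt t) (y - z)) \<partial>lborel) =
      (\<integral>\<^sup>+y. ennreal (normal_density 0 (sqrt s) (x - z - y) * normal_density 0 (sqrt t) y) \<partial>lborel)"
    by (subst nn_integral_real_affine[where c = 1 and t = z])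
      (auto simp: ennreal_mult algebra_simps)
  also have "\<dots> = ennreal (normal_density 0 (sqrt (s + t)) (x - z))"
    using conv_normal_density_zero_mean[of "sqrt s" "sqrt t"] assms by (simp add: fun_eq_iff)
  finally show ?thesis .
qed

lemma gauss_kernels: "symmetric_markov_kernels (Pi\<^sub>M {..<n} (\<lambda>_. lborel)) (gauss_kernel n)"
proof -
  interpret product_sigma_finite "\<lambda>_::nat. lborel :: real measure" ..
  interpret finite_product_sigma_finite "\<lambda>_. lborel :: real measure" "{..<n}"
    by standard auto
  show ?thesis
  proof
    fix t :: real assume t: "t > 0"
    show "case_prod (gauss_kernel n t) \<in>
        borel_measurable (Pi\<^sub>M {..<n} (\<lambda>_. lborel) \<Otimes>\<^sub>M Pi\<^sub>M {..<n} (\<lambda>_. lborel))"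
      unfolding gauss_kernel_def[abs_def] by measurable
    show "gauss_kernel n t x y = gauss_kernel n t y x" for x y
      by (simp add: gauss_kernel_def normal_density_def power2_commute)
    show "(\<integral>\<^sup>+ y. gauss_kernel n t x y \<partial>Pi\<^sub>M {..<n} (\<lambda>_. lborel)) = 1" for x
      unfolding gauss_kernel_def using t
      by (subst product_nn_integral_prod) (auto simp: nn_integral_normal_density_shift)
    show "(\<integral>\<^sup>+ y. gauss_kernel n s x y * gauss_kernel n t y z \<partial>Pi\<^sub>M {..<n} (\<lambda>_. lborel)) =
        gauss_kernel n (s + t) x z" if "s > 0" for s x z
      unfolding gauss_kernel_def prod.distrib[symmetric] using t that
      by (subst product_nn_integral_prod) (auto simp: normal_density_convolution distrib_left)
  qed
qed

section \<open>Comparison of heat kernels at nearby times\<close>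

text \<open>The exponential increases with time, so only the normalising factors matter; their ratio
  is \<open>sqrt (t / s)\<close>.\<close>

lemma normal_density_scale_le:
  assumes "0 < s" "s \<le> t"
  shows "normal_density 0 (sqrt (2 * s)) z \<le> sqrt (t / s) * normal_density 0 (sqrt (2 * t)) z"
proof -
  have "exp (- z\<^sup>2 / (4 * s)) \<le> exp (- z\<^sup>2 / (4 * t))"
    using assms by (simp add: frac_le)
  then have "1 / sqrt (4 * pi * s) * exp (- z\<^sup>2 / (4 * s)) \<le> 1 / sqrt (4 * pi * s) * exp (- z\<^sup>2 / (4 * t))"
    using assms by (intro mult_left_mono) auto
  also have "\<dots> = sqrt (t / s) * (1 / sqrt (4 * pi * t)) * exp (- z\<^sup>2 / (4 * t))"
    using assms by (simp add: real_sqrt_mult real_sqrt_divide)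
  finally show ?thesis
    using assms unfolding normal_density_def by (simp add: mult.assoc[symmetric])
qed

text \<open>The \<open>n\<close> coordinates together lose the square root of
  \<open>(t / s) ^ n\<close>, which is at most 2.\<close>

lemma gauss_kernel_le:
  assumes "0 < s" "s \<le> t" "(t / s) ^ n \<le> 4"
  shows "gauss_kernel n s x y \<le> 2 * gauss_kernel n t x y"
proof -
  have "gauss_kernel n s x y \<le> (\<Prod>i<n. ennreal (sqrt (t / s) * normal_density 0 (sqrt (2 * t)) (x i - y i)))"
    unfolding gauss_kernel_def using assms
    by (subst (1 2) prod_ennreal) (auto intro!: ennreal_leI prod_mono normal_density_scale_le)
  also have "\<dots> = ennreal (sqrt (t / s) ^ n) * gauss_kernel n t x y"
    unfolding gauss_kernel_def using assms
    by (simp add: ennreal_mult prod.distrib ennreal_power)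
  also have "\<dots> \<le> ennreal 2 * gauss_kernel n t x y"
  proof (intro mult_right_mono ennreal_leI)
    have "sqrt (t / s) ^ n = sqrt ((t / s) ^ n)"
      by (simp add: real_sqrt_power)
    also have "\<dots> \<le> sqrt 4" using assms(3) by (intro real_sqrt_le_mono)
    finally show "sqrt (t / s) ^ n \<le> 2" by simp
  qed simp
  finally show ?thesis by simp
qed

context
  fixes n :: nat
  assumes n: "n \<ge> 1"
begin

interpretation G: symmetric_markov_kernels "Pi\<^sub>M {..<n} (\<lambda>_. lborel)" "gauss_kernel n"
  by (rule gauss_kernels)

lemma heat_semigroup_le:
  assumes "0 < s" "s \<le> t" "(t / s) ^ n \<le> 4"
    and [measurable]: "g \<in> borel_measurable (Pi\<^sub>M {..<n} (\<lambda>_. lborel))" 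
    and x: "x \<in> space (Pi\<^sub>M {..<n} (\<lambda>_. lborel))"
  shows "G.P s g x \<le> 2 * G.P t g x"
proof -
  have [measurable]: "gauss_kernel n t x \<in> borel_measurable (Pi\<^sub>M {..<n} (\<lambda>_. lborel))"
    using assms by (intro G.k_measurable') auto
  have "G.P s g x \<le> (\<integral>\<^sup>+y. 2 * (gauss_kernel n t x y * g y) \<partial>Pi\<^sub>M {..<n} (\<lambda>_. lborel))"
    using assms unfolding G.P_def
    by (auto simp flip: mult.assoc intro!: nn_integral_mono mult_right_mono gauss_kernel_le)
  also have "\<dots> = 2 * G.P t g x"
    using assms by (simp add: G.P_def nn_integral_cmult)
  finally show ?thesis .
qed

section \<open>The geometric grid of times\<close>

text \<open>Its \<open>n\<close>-th power stays below \<open>exp 1\<close>, so rounding a time up to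
  the grid at most doubles the kernel.\<close>

definition grid_ratio :: real where "grid_ratio = 1 + 1 / real n"

lemma grid_ratio: "1 < grid_ratio" "grid_ratio ^ n \<le> 4"
proof -
  show "1 < grid_ratio" using n by (simp add: grid_ratio_def)
  have "grid_ratio ^ n \<le> exp (1 / real n) ^ n"
    unfolding grid_ratio_def by (intro power_mono) (auto simp: exp_ge_add_one_self)
  also have "\<dots> = exp 1" using n by (simp add: exp_of_nat_mult[symmetric])
  also have "\<dots> \<le> 4" using exp_le by simp
  finally show "grid_ratio ^ n \<le> 4" .
qed

text \<open>Bernoulli's inequality gives
  \<open>grid_ratio ^ (j - i) \<ge> 1 + (j - i) / n \<ge> 2 * n\<close>. The earlier time is thus at
  most the fraction \<open>q = 1 / (2 * n)\<close> of the later one, and again by Bernoulli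
  \<open>(1 - q) ^ n \<ge> 1 / 2\<close>, so the kernels compare with factor 2.\<close>

lemma heat_grid_far:
  assumes a: "0 < a" and l: "2 * n\<^sup>2 \<le> 2 ^ l" and ij: "i + 2 ^ l \<le> j"
    and g: "g \<in> borel_measurable (Pi\<^sub>M {..<n} (\<lambda>_. lborel))" 
    and x: "x \<in> space (Pi\<^sub>M {..<n} (\<lambda>_. lborel))"
  shows "G.P (a * grid_ratio ^ j - a * grid_ratio ^ i) g x \<le> 2 * G.P (a * grid_ratio ^ j) g x"
proof (intro heat_semigroup_le g x)
  let ?r = grid_ratio
  define q where "q = 1 / (2 * real n)"
  have q: "0 < q" "q \<le> 1 / 2" using n by (auto simp: q_def field_simps)
  have "2 * real n \<le> 1 + real (2 * n\<^sup>2) * (1 / real n)"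
    using n by (simp add: power2_eq_square)
  also have "\<dots> \<le> 1 + real (j - i) * (1 / real n)"
  proof -
    have "2 * n\<^sup>2 \<le> j - i" using l ij by linarith
    then show ?thesis by (intro add_left_mono mult_right_mono) (simp_all only: of_nat_le_iff, auto)
  qed
  also have "\<dots> \<le> ?r ^ (j - i)"
  proof -
    have "(-1::real) \<le> 1 / real n" by (rule order_trans[of _ 0]) auto
    from Bernoulli_inequality[OF this, of "j - i"] show ?thesis
      by (simp add: grid_ratio_def)
  qed
  finally have "2 * real n * ?r ^ i \<le> ?r ^ (j - i) * ?r ^ i"
    using grid_ratio(1) by (intro mult_right_mono) auto
  also have "\<dots> = ?r ^ j" using ij by (simp flip: power_add)
  finally have "?r ^ i \<le> q * ?r ^ j"
    using n by (simp add: q_def field_simps)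
  then have *: "a * ?r ^ i \<le> q * (a * ?r ^ j)"
    using a by (simp add: mult.left_commute)
  have pos: "0 < a * ?r ^ j" "0 < a * ?r ^ i" using a grid_ratio(1) by simp_all
  have lower: "(1 - q) * (a * ?r ^ j) \<le> a * ?r ^ j - a * ?r ^ i"
    using * by (simp add: left_diff_distrib)
  moreover have "0 < (1 - q) * (a * ?r ^ j)" using q by (intro mult_pos_pos[OF _ pos(1)]) auto
  ultimately show diff: "0 < a * ?r ^ j - a * ?r ^ i" by linarith
  show "a * ?r ^ j - a * ?r ^ i \<le> a * ?r ^ j" using pos by simp
  have "a * ?r ^ j / (a * ?r ^ j - a * ?r ^ i) \<le> 1 / (1 - q)"
    using lower diff q by (simp add: field_simps)
  then have "(a * ?r ^ j / (a * ?r ^ j - a * ?r ^ i)) ^ n \<le> (1 / (1 - q)) ^ n"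
    using pos diff by (intro power_mono) auto
  also have "1 / 2 \<le> (1 - q) ^ n"
    using Bernoulli_inequality[of "- q" n] q n by (simp add: q_def)
  then have "(1 / (1 - q)) ^ n \<le> 4"
    using q by (simp add: power_one_over field_simps)
  finally show "(a * ?r ^ j / (a * ?r ^ j - a * ?r ^ i)) ^ n \<le> 4" .
qed

lemma grid_ratio_approx:
  assumes "t > 0"
  obtains z where "t \<le> grid_ratio powi z" "grid_ratio powi z \<le> grid_ratio * t"
proof
  let ?z = "\<lceil>log grid_ratio t\<rceil>"
  note r = grid_ratio(1)
  have powi: "grid_ratio powi z = grid_ratio powr (of_int z)" for z
    using r by (simp add: powr_real_of_int')
  have t: "grid_ratio powr (log grid_ratio t) = t"
    using r assms by simp
  have "grid_ratio powr (log grid_ratio t) \<le> grid_ratio powr (of_int ?z)"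
    using r by (subst powr_le_cancel_iff) auto
  then show "t \<le> grid_ratio powi ?z"
    using t by (simp add: powi)
  have "grid_ratio powr (of_int ?z) \<le> grid_ratio powr (1 + log grid_ratio t)"
    using r by (subst powr_le_cancel_iff) (simp_all, linarith)
  also have "\<dots> = grid_ratio * t"
    using r t by (simp add: powr_add)
  finally show "grid_ratio powi ?z \<le> grid_ratio * t"
    by (simp add: powi)
qed

text \<open>The two-sided grid is exhausted by the exponents from \<open>-K\<close> to
  \<open>K\<close>, and the bound, uniform in \<open>K\<close>, passes to the increasing union. The
  level drops from \<open>2 * \<beta>\<close> to \<open>\<beta>\<close> by rounding to the grid; 7
  is \<open>5 + D\<close> with \<open>D = 2\<close>. The cover \<open>E\<close> is a countable
  union, hence measurable, while the superlevel set is an uncountable one.\<close>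

lemma heat_weak_type:
  assumes l: "2 * n\<^sup>2 \<le> 2 ^ l"
    and \<phi>[measurable]: "\<phi> \<in> borel_measurable (Pi\<^sub>M {..<n} (\<lambda>_. lborel))"
    and fin: "(\<integral>\<^sup>+x. \<phi> x \<partial>Pi\<^sub>M {..<n} (\<lambda>_. lborel)) < \<infinity>"
    and \<beta>: "0 < \<beta>" "\<beta> < \<infinity>"
  obtains E where "E \<in> sets (Pi\<^sub>M {..<n} (\<lambda>_. lborel))"
    and "{x \<in> space (Pi\<^sub>M {..<n} (\<lambda>_. lborel)). \<exists>t>0. 2 * \<beta> < G.P t \<phi> x} \<subseteq> E"
    and "\<beta> * emeasure (Pi\<^sub>M {..<n} (\<lambda>_. lborel)) E \<le>
      4 * of_nat (7 + 2 * l) * (\<integral>\<^sup>+x. \<phi> x \<partial>Pi\<^sub>M {..<n} (\<lambda>_. lborel))"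
proof
  let ?M = "Pi\<^sub>M {..<n} (\<lambda>_. lborel :: real measure)"
  let ?r = grid_ratio
  note r = grid_ratio(1)
  define A where "A z = {x \<in> space ?M. \<beta> < G.P (?r powi z) \<phi> x}" for z
  define E where "E K = (\<Union>i<2 * K + 1. A (int i - int K))" for K
  have [measurable]: "A z \<in> sets ?M" for z
  proof -
    have "0 \<le> ?r powi z" using r by (intro zero_le_power_int) simp
    then show ?thesis unfolding A_def by measurable
  qed
  have E[measurable]: "E K \<in> sets ?M" for K
    unfolding E_def by measurable
  show "(\<Union>K. E K) \<in> sets ?M" by measurable
  show "{x \<in> space ?M. \<exists>t>0. 2 * \<beta> < G.P t \<phi> x} \<subseteq> (\<Union>K. E K)"
  proof safe
    fix x t assume x: "x \<in> space ?M" and t: "t > 0" "2 * \<beta> < G.P t \<phi> x"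
    obtain z where z: "t \<le> ?r powi z" "?r powi z \<le> ?r * t"
      using grid_ratio_approx[OF t(1)] .
    have "(?r powi z / t) ^ n \<le> ?r ^ n"
      using z t by (intro power_mono) (auto simp: field_simps)
    then have "G.P t \<phi> x \<le> 2 * G.P (?r powi z) \<phi> x"
      using x z(1) t grid_ratio(2) by (intro heat_semigroup_le) auto
    with t have "2 * \<beta> < 2 * G.P (?r powi z) \<phi> x" by simp
    then have "\<beta> < G.P (?r powi z) \<phi> x"
      by (meson mult_left_mono not_le zero_le)
    then have "x \<in> A z"
      using x by (simp add: A_def)
    \<comment> \<open>Witnesses for membership in the union: window size
      \<open>\<bar>z\<bar>\<close> and index \<open>z + \<bar>z\<bar>\<close>.\<close>
    moreover have "z = int (nat (z + \<bar>z\<bar>)) - int (nat \<bar>z\<bar>)" "nat (z + \<bar>z\<bar>) < 2 * nat \<bar>z\<bar> + 1" by auto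
    ultimately have "x \<in> E (nat \<bar>z\<bar>)" unfolding E_def by (metis UN_I lessThan_iff)
    then show "x \<in> (\<Union>K. E K)" by auto
  qed
  have "incseq E"
  proof (rule incseq_SucI, rule subsetI)
    fix K x assume "x \<in> E K"
    then obtain i where "i < 2 * K + 1" "x \<in> A (int i - int K)" by (auto simp: E_def)
    then show "x \<in> E (Suc K)"
      unfolding E_def by (intro UN_I[of "Suc i"]) auto
  qed
  have "\<beta> * emeasure ?M (E K) \<le> 4 * of_nat (5 + 2 * l + 2) * (\<integral>\<^sup>+x. \<phi> x \<partial>?M)" for K
  proof -
    \<comment> \<open>Factoring out the smallest time of the window turns it into the sequence
      \<open>a * grid_ratio ^ i\<close> indexed from 0.\<close>
    define a where "a = ?r powi (- int K)"
    have a: "a > 0" unfolding a_def using r by simp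
    have eq: "?r powi (int i - int K) = a * ?r ^ i" for i
      unfolding a_def using r by (simp add: power_int_diff power_int_minus field_simps)
    show ?thesis
      unfolding E_def A_def eq
    proof (rule G.weak_type_maximal)
      show "mono (\<lambda>i. a * ?r ^ i)"
        using a r by (auto intro!: monoI mult_left_mono power_increasing)
      show "G.P (a * ?r ^ j - a * ?r ^ i) g x \<le> of_nat 2 * G.P (a * ?r ^ j) g x"
        if "i + 2 ^ l \<le> j" "g \<in> borel_measurable ?M" "x \<in> space ?M" for i j g x
        using heat_grid_far[OF a l that] by simp
    qed (use a fin \<beta> in auto)
  qed
  then have "(SUP K. \<beta> * emeasure ?M (E K)) \<le> 4 * of_nat (7 + 2 * l) * (\<integral>\<^sup>+x. \<phi> x \<partial>?M)"
    by (intro SUP_least) (simp add: add.commute)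
  then show "\<beta> * emeasure ?M (\<Union>K. E K) \<le> 4 * of_nat (7 + 2 * l) * (\<integral>\<^sup>+x. \<phi> x \<partial>?M)"
    using \<open>incseq E\<close> by (subst SUP_emeasure_incseq[symmetric]) (auto simp: SUP_mult_left_ennreal)
qed

section \<open>Transfer to the maximal function of a complex integrable function\<close>

lemma norm_heat_op_le:
  assumes t: "t > 0" and f[measurable]: "f \<in> borel_measurable (leb n)"
    and ae: "AE y in Pi\<^sub>M {..<n} (\<lambda>_. lborel). ennreal (norm (f y)) = \<phi> y"
  shows "ennreal (norm (heat_op n t f x)) \<le> G.P t \<phi> x"
proof -
  let ?h = "\<lambda>y. complex_of_real (heat_kernel n t (\<lambda>i\<in>{..<n}. x i - y i)) * f y"
  have "ennreal (norm (heat_op n t f x)) \<le> (\<integral>\<^sup>+y. ennreal (norm (?h y)) \<partial>leb n)"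
    unfolding heat_op_def convolve_def
    \<comment> \<open>If the integrand is not integrable, its Bochner integral is 0 by convention
      and the bound is trivial.\<close>
    by (cases "integrable (leb n) ?h") (auto simp: integral_norm_bound_ennreal not_integrable_integral_eq)
  also have "\<dots> = (\<integral>\<^sup>+y. gauss_kernel n t x y * ennreal (norm (f y)) \<partial>Pi\<^sub>M {..<n} (\<lambda>_. lborel))"
    unfolding leb_def nn_integral_completion
  proof (intro nn_integral_cong)
    fix y
    have "0 \<le> heat_kernel n t (\<lambda>i\<in>{..<n}. x i - y i)" by (simp add: heat_kernel_def)
    then show "ennreal (norm (?h y)) = gauss_kernel n t x y * ennreal (norm (f y))"
      using t by (simp add: norm_mult ennreal_mult gauss_kernel_eq_heat_kernel)
  qed
  also have "\<dots> = G.P t \<phi> x"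
    using t ae by (auto simp: G.P_def intro!: nn_integral_cong_AE)
  finally show ?thesis .
qed

lemma heat_maximal_weak_type:
  assumes f: "integrable (leb n) f" and l: "2 * n\<^sup>2 \<le> 2 ^ l"
  shows "weak_L1_norm n (heat_maximal n f) \<le> ennreal (8 * real (7 + 2 * l)) * L1_norm n f"
  unfolding weak_L1_norm_def
proof (rule SUP_least)
  let ?M = "Pi\<^sub>M {..<n} (\<lambda>_. lborel :: real measure)"
  fix \<alpha> :: real assume "\<alpha> \<in> {0<..}"
  then have \<alpha>: "\<alpha> > 0" by simp
  have fm: "f \<in> borel_measurable (leb n)" using f by simp
  then have "(\<lambda>x. ennreal (norm (f x))) \<in> borel_measurable (completion ?M)"
    unfolding leb_def by measurable
  \<comment> \<open>\<open>f\<close> is measurable only for the completion, whereas the semigroup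
    acts on Borel functions; a Borel function equal to the modulus of \<open>f\<close> almost
    everywhere has the same integrals.\<close>
  then obtain \<phi> where \<phi>: "\<phi> \<in> borel_measurable ?M" "AE x in ?M. ennreal (norm (f x)) = \<phi> x"
    using completion_ex_borel_measurable by blast
  have L1: "L1_norm n f = (\<integral>\<^sup>+x. \<phi> x \<partial>?M)"
    unfolding L1_norm_def leb_def nn_integral_completion using \<phi>(2) by (rule nn_integral_cong_AE)
  have "L1_norm n f < \<infinity>"
    using f unfolding L1_norm_def integrable_iff_bounded by simp
  then have fin: "(\<integral>\<^sup>+x. \<phi> x \<partial>?M) < \<infinity>" by (simp add: L1)
  define \<beta> where "\<beta> = ennreal (\<alpha> / 2)"
  have \<beta>: "0 < \<beta>" "\<beta> < \<infinity>" and 2: "ennreal \<alpha> = 2 * \<beta>"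
    using \<alpha> by (auto simp: \<beta>_def simp flip: ennreal_mult ennreal_numeral)
  obtain E where E: "E \<in> sets ?M" "{x \<in> space ?M. \<exists>t>0. 2 * \<beta> < G.P t \<phi> x} \<subseteq> E"
      "\<beta> * emeasure ?M E \<le> 4 * of_nat (7 + 2 * l) * (\<integral>\<^sup>+x. \<phi> x \<partial>?M)"
    using heat_weak_type[OF l \<phi>(1) fin \<beta>] by blast
  have "{x \<in> space (leb n). ennreal \<alpha> < heat_maximal n f x} \<subseteq> E"
  proof (rule subset_trans[OF _ E(2)], safe)
    fix x assume x: "x \<in> space (leb n)" "ennreal \<alpha> < heat_maximal n f x"
    then show "x \<in> space ?M" by (simp add: leb_def)
    from x(2) obtain t where "t > 0" "ennreal \<alpha> < ennreal (norm (heat_op n t f x))"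
      unfolding heat_maximal_def less_SUP_iff by auto
    then show "\<exists>t>0. 2 * \<beta> < G.P t \<phi> x"
      using norm_heat_op_le[OF _ fm \<phi>(2), of t x] unfolding 2 by (auto intro: less_le_trans)
  qed
  then have "ennreal \<alpha> * emeasure (leb n) {x \<in> space (leb n). ennreal \<alpha> < heat_maximal n f x} \<le>
      2 * \<beta> * emeasure (leb n) E"
    unfolding 2 using E(1) by (intro mult_left_mono emeasure_mono) (auto simp: leb_def)
  also have "\<dots> = 2 * (\<beta> * emeasure ?M E)"
    using E(1) by (simp add: leb_def mult.assoc)
  also have "\<dots> \<le> 2 * (4 * of_nat (7 + 2 * l) * L1_norm n f)"
    unfolding L1 by (intro mult_left_mono E) simp
  also have "\<dots> = ennreal (8 * real (7 + 2 * l)) * L1_norm n f"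
    by (simp add: ennreal_mult ennreal_of_nat_eq_real_of_nat mult.assoc[symmetric] del: of_nat_add of_nat_mult)
  finally show "ennreal \<alpha> * emeasure (leb n) {x \<in> space (leb n). ennreal \<alpha> < heat_maximal n f x} \<le>
      ennreal (8 * real (7 + 2 * l)) * L1_norm n f" .
qed

end

section \<open>Choice of the constant\<close>

text \<open>The least suitable power of two is at most
  \<open>(2 * n)\<^sup>2 \<le> (1 + n) ^ 4\<close>, so the exponent is at most
  \<open>4 * ln (1 + n) / ln 2\<close>. The constant is \<open>120 = 8 * 7 + 16 * 4\<close>, where
  \<open>ln 2 \<le> ln (1 + n)\<close> absorbs the additive part.\<close>

lemma dyadic_exponent:
  fixes n :: nat assumes n: "n \<ge> 1"
  obtains l where "2 * n\<^sup>2 \<le> 2 ^ l" "8 * real (7 + 2 * l) \<le> 120 / ln 2 * ln (1 + real n)"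
proof -
  have "2 \<le> 2 * n\<^sup>2" using n by simp
  then obtain l where l: "2 ^ l < 2 * n\<^sup>2" "2 * n\<^sup>2 \<le> 2 ^ (l + 1)"
    using ex_power_ivl2[of 2 "2 * n\<^sup>2"] by auto
  have "2 ^ (l + 1) \<le> (2 * n)\<^sup>2" using l(1) by (simp add: power_mult_distrib)
  also have "2 * n \<le> (1 + n)\<^sup>2" by (simp add: power2_eq_square)
  then have "(2 * n)\<^sup>2 \<le> ((1 + n)\<^sup>2)\<^sup>2" by (rule power_mono) simp
  also have "\<dots> = (1 + n) ^ 4" by (simp flip: power_mult)
  finally have "real (2 ^ (l + 1)) \<le> real ((1 + n) ^ 4)" by (simp only: of_nat_le_iff)
  then have "(2::real) ^ (l + 1) \<le> (1 + real n) ^ 4" by simp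
  then have "ln ((2::real) ^ (l + 1)) \<le> ln ((1 + real n) ^ 4)"
    by (subst ln_le_cancel_iff) auto
  then have "real (l + 1) * ln 2 \<le> 4 * ln (1 + real n)"
    by (simp add: ln_realpow del: power_Suc)
  moreover have "ln 2 \<le> ln (1 + real n)" using n by (intro ln_mono) auto
  moreover have "8 * real (7 + 2 * (l + 1)) * ln 2 = 56 * ln 2 + 16 * (real (l + 1) * ln 2)"
    by (simp add: algebra_simps)
  ultimately have "8 * real (7 + 2 * (l + 1)) * ln 2 \<le> 120 * ln (1 + real n)"
    by linarith
  then have "8 * real (7 + 2 * (l + 1)) \<le> 120 / ln 2 * ln (1 + real n)"
    by (simp add: field_simps)
  with l(2) show ?thesis by (rule that)
qed

theorem theorem1p2:
  "\<exists>C::real. C > 0 \<and>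
     (\<forall>n::nat. n \<ge> 1 \<longrightarrow>
       (\<forall>f :: (nat \<Rightarrow> real) \<Rightarrow> complex. integrable (leb n) f \<longrightarrow>
          weak_L1_norm n (heat_maximal n f) \<le> ennreal (C * ln (1 + real n)) * L1_norm n f))"
proof (intro exI[of _ "120 / ln 2"] conjI allI impI)
  fix n :: nat and f :: "(nat \<Rightarrow> real) \<Rightarrow> complex"
  assume n: "n \<ge> 1" and f: "integrable (leb n) f"
  obtain l where l: "2 * n\<^sup>2 \<le> 2 ^ l" "8 * real (7 + 2 * l) \<le> 120 / ln 2 * ln (1 + real n)"
    using dyadic_exponent[OF n] .
  have "weak_L1_norm n (heat_maximal n f) \<le> ennreal (8 * real (7 + 2 * l)) * L1_norm n f"
    by (rule heat_maximal_weak_type[OF n f l(1)])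
  also have "\<dots> \<le> ennreal (120 / ln 2 * ln (1 + real n)) * L1_norm n f"
    using l(2) by (intro mult_right_mono ennreal_leI) auto
  finally show "weak_L1_norm n (heat_maximal n f) \<le> ennreal (120 / ln 2 * ln (1 + real n)) * L1_norm n f" .
qed simp

end
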